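(* For every integer $n\ge 3$, $$\chi_{la}(Sp(2^{[n]}))=\begin{cases} n+2 & \text{if } n\ge 4,\\ n+1 & \text{otherwise.}\end{cases}$$
   Context: Graphs are finite and simple. Let $G=(V,E)$ be a connected graph of order at least 3. A local antimagic labeling of $G$ is a bijection $f:E\to\{1,\dots,|E|\}$ such that the induced vertex labeling $f^+(u)=\sum f(e)$ (sum over all edges $e$ incident to $u$) satisfies $f^+(x)\ne f^+(y)$ for every pair of adjacent vertices $x,y$. Let $c(f)$ be the number of distinct values of $f^+$. The local antimagic chromatic number is $\chi_{la}(G)=\min\{c(f): f \text{ is a local antimagic labeling of } G\}$ (every connected graph of order at least 3 admits such a labeling). For $n\ge 3$, $Sp(2^{[n]})$ denotes the spider with $n$ legs of length 2: the tree formed by taking $n$ paths of length 2 and identifying one end-vertex of each of them into a single vertex. Explicitly, its vertices are $u,v_1,\dots,v_n,w_1,\dots,w_n$ and its edges are $uv_i$ and $v_iw_i$ for $1\le i\le n$. *)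

theory Defs
  imports Main
begin

text \<open>
  An undirected graph is a pair of a vertex set and an edge set, an edge \<open>xy\<close> being the
  two-element set \<open>{x, y}\<close>.
\<close>

type_synonym 'a graph = "'a set \<times> 'a set set"

abbreviation verts :: "'a graph \<Rightarrow> 'a set" where "verts G \<equiv> fst G"
abbreviation edges :: "'a graph \<Rightarrow> 'a set set" where "edges G \<equiv> snd G"

definition finite_simple_graph :: "'a graph \<Rightarrow> bool" where
  "finite_simple_graph G \<longleftrightarrow> finite (verts G) \<and>
     (\<forall>e \<in> edges G. \<exists>x \<in> verts G. \<exists>y \<in> verts G. x \<noteq> y \<and> e = {x, y})"

definition connected_graph :: "'a graph \<Rightarrow> bool" where
  "connected_graph G \<longleftrightarrow> verts G \<noteq> {} \<and>
     (\<forall>x \<in> verts G. \<forall>y \<in> verts G. (x, y) \<in> {(a, b). {a, b} \<in> edges G}\<^sup>*)"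

definition vertex_label :: "'a graph \<Rightarrow> ('a set \<Rightarrow> nat) \<Rightarrow> 'a \<Rightarrow> nat" where
  "vertex_label G f u = (\<Sum>e | e \<in> edges G \<and> u \<in> e. f e)"

definition local_antimagic :: "'a graph \<Rightarrow> ('a set \<Rightarrow> nat) \<Rightarrow> bool" where
  "local_antimagic G f \<longleftrightarrow> bij_betw f (edges G) {1..card (edges G)} \<and>
     (\<forall>x \<in> verts G. \<forall>y \<in> verts G. {x, y} \<in> edges G \<longrightarrow>
        vertex_label G f x \<noteq> vertex_label G f y)"

definition num_colors :: "'a graph \<Rightarrow> ('a set \<Rightarrow> nat) \<Rightarrow> nat" where
  "num_colors G f = card (vertex_label G f ` verts G)"

text \<open>
  The minimum is meaningful only for graphs that have a local antimagic labeling, in particular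
  for finite simple connected graphs of order at least 3; otherwise the value is unspecified.
\<close>

definition local_antimagic_chromatic_number :: "'a graph \<Rightarrow> nat" where
  "local_antimagic_chromatic_number G =
     (LEAST k. \<exists>f. local_antimagic G f \<and> num_colors G f = k)"

text \<open>
  The spider with \<open>n\<close> legs of length 2: \<open>Centre\<close> is \<open>u\<close>, \<open>Mid i\<close> is \<open>v\<^sub>i\<close>, \<open>Tip i\<close> is \<open>w\<^sub>i\<close>.
\<close>

datatype spider_vertex = Centre | Mid nat | Tip nat

definition spider2 :: "nat \<Rightarrow> spider_vertex graph" where
  "spider2 n =
     ({Centre} \<union> Mid ` {1..n} \<union> Tip ` {1..n},
      (\<lambda>i. {Centre, Mid i}) ` {1..n} \<union> (\<lambda>i. {Mid i, Tip i}) ` {1..n})"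

lemma spider2_simple: "finite_simple_graph (spider2 n)"
proof -
  have "\<exists>x \<in> verts (spider2 n). \<exists>y \<in> verts (spider2 n). x \<noteq> y \<and> e = {x, y}"
    if e: "e \<in> edges (spider2 n)" for e
  proof -
    from e consider i where "i \<in> {1..n}" "e = {Centre, Mid i}"
      | i where "i \<in> {1..n}" "e = {Mid i, Tip i}"
      by (auto simp: spider2_def)
    then show ?thesis
    proof cases
      case (1 i)
      then show ?thesis
        by (intro bexI[of _ Centre] bexI[of _ "Mid i"]) (simp_all add: spider2_def)
    next
      case (2 i)
      then show ?thesis
        by (intro bexI[of _ "Mid i"] bexI[of _ "Tip i"]) (simp_all add: spider2_def)
    qed
  qed
  moreover have "finite (verts (spider2 n))"
    by (simp add: spider2_def)
  ultimately show ?thesis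
    by (simp add: finite_simple_graph_def)
qed

lemma spider2_order: "card (verts (spider2 n)) = 2 * n + 1"
proof -
  have "card (Mid ` {1..n} \<union> Tip ` {1..n}) = n + n"
    by (subst card_Un_disjoint) (auto simp: card_image inj_on_def)
  then show ?thesis
    unfolding spider2_def by (auto simp: card_insert_if)
qed

lemma spider2_size: "card (edges (spider2 n)) = 2 * n"
proof -
  let ?A = "(\<lambda>i. {Centre, Mid i}) ` {1..n}" and ?B = "(\<lambda>i. {Mid i, Tip i}) ` {1..n}"
  have "card ?A = n" "card ?B = n"
    by (simp_all add: card_image inj_on_def doubleton_eq_iff)
  moreover have "?A \<inter> ?B = {}"
    by (auto simp: doubleton_eq_iff)
  ultimately show ?thesis
    by (simp add: spider2_def card_Un_disjoint)
qed

lemma spider2_connected: "connected_graph (spider2 n)"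
proof -
  let ?R = "{(a, b). {a, b} \<in> edges (spider2 n)}"
  have centre: "Centre \<in> verts (spider2 n)"
    by (simp add: spider2_def)
  have symR: "sym (?R\<^sup>*)"
    by (intro sym_rtrancl) (simp add: sym_def insert_commute)
  have to_centre: "(x, Centre) \<in> ?R\<^sup>*" if x: "x \<in> verts (spider2 n)" for x
  proof -
    have mid: "(Mid i, Centre) \<in> ?R" if "i \<in> {1..n}" for i
      using that by (auto simp: spider2_def insert_commute)
    have tip: "(Tip i, Mid i) \<in> ?R" if "i \<in> {1..n}" for i
      using that by (auto simp: spider2_def insert_commute)
    from x consider "x = Centre" | i where "i \<in> {1..n}" "x = Mid i"
      | i where "i \<in> {1..n}" "x = Tip i"
      by (auto simp: spider2_def)
    then show ?thesis
    proof cases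
      case 1
      then show ?thesis by simp
    next
      case 2
      then show ?thesis using mid by (metis r_into_rtrancl)
    next
      case 3
      then show ?thesis using mid[of i] tip[of i]
        by (meson r_into_rtrancl rtrancl_trans)
    qed
  qed
  have "(x, y) \<in> ?R\<^sup>*" if "x \<in> verts (spider2 n)" "y \<in> verts (spider2 n)" for x y
    by (rule rtrancl_trans[OF to_centre[OF that(1)] symD[OF symR to_centre[OF that(2)]]])
  then show ?thesis
    unfolding connected_graph_def using centre by blast
qed

end

theory Submission
  imports Defs
begin

text \<open>
  Write \<open>a\<^sub>i\<close> for the label of the inner edge \<open>{Centre, Mid i}\<close> and \<open>b\<^sub>i\<close> for that of the pendant
  edge \<open>{Mid i, Tip i}\<close>. The colours are then the sum \<open>S\<close> of all the \<open>a\<^sub>i\<close> at the centre, \<open>a\<^sub>i + b\<^sub>i\<close>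
  at \<open>Mid i\<close> and \<open>b\<^sub>i\<close> at \<open>Tip i\<close>.

  Lower bound: the \<open>n\<close> tips carry \<open>n\<close> distinct colours, none above \<open>2n\<close>. The edge labelled \<open>2n\<close>,
  inner or pendant, belongs to some leg \<open>j\<close>, and \<open>a\<^sub>j + b\<^sub>j > 2n\<close> is a further colour. If \<open>n \<ge> 4\<close>,
  then \<open>S\<close>, a sum of \<open>n\<close> distinct positive integers, is at least \<open>n (n + 1) / 2 > 2n\<close>; it differs
  from \<open>a\<^sub>j + b\<^sub>j\<close> because \<open>Mid j\<close> is adjacent to the centre, so it is yet another colour. These
  two facts are \<open>num_colors_spider2_lower\<close> and \<open>num_colors_spider2_lower_large\<close>.

  Upper bound: the complementary labeling \<open>a\<^sub>i = i\<close>, \<open>b\<^sub>i = 2n + 1 - i\<close> gives the tips the colours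
  \<open>n + 1, \<dots>, 2n\<close>, all middle vertices the one colour \<open>2n + 1\<close>, and the centre the colour
  \<open>n (n + 1) / 2\<close>. The last is never \<open>2n + 1\<close>, since \<open>n\<^sup>2 - 3n - 2\<close> has no integer root. This makes
  at most \<open>n + 2\<close> colours, and for \<open>n = 3\<close> the centre's colour 6 coincides with that of a tip,
  which saves one.
\<close>

section \<open>Colours in a labeled spider\<close>

lemma edges_spider2:
  "edges (spider2 n) = (\<lambda>i. {Centre, Mid i}) ` {1..n} \<union> (\<lambda>i. {Mid i, Tip i}) ` {1..n}"
  by (simp add: spider2_def)

lemma verts_spider2: "verts (spider2 n) = {Centre} \<union> Mid ` {1..n} \<union> Tip ` {1..n}"
  by (simp add: spider2_def)

lemma vertex_label_Centre:
  "vertex_label (spider2 n) f Centre = (\<Sum>i = 1..n. f {Centre, Mid i})"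
proof -
  have "{e \<in> edges (spider2 n). Centre \<in> e} = (\<lambda>i. {Centre, Mid i}) ` {1..n}"
    by (auto simp: edges_spider2)
  moreover have "inj_on (\<lambda>i. {Centre, Mid i}) {1..n}"
    by (auto simp: inj_on_def doubleton_eq_iff)
  ultimately show ?thesis
    by (simp add: vertex_label_def sum.reindex)
qed

lemma vertex_label_Mid:
  assumes "i \<in> {1..n}"
  shows "vertex_label (spider2 n) f (Mid i) = f {Centre, Mid i} + f {Mid i, Tip i}"
proof -
  have "{e \<in> edges (spider2 n). Mid i \<in> e} = {{Centre, Mid i}, {Mid i, Tip i}}"
    using assms by (auto simp: edges_spider2)
  moreover have "{Centre, Mid i} \<noteq> {Mid i, Tip i}"
    by (simp add: doubleton_eq_iff)
  ultimately show ?thesis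
    by (simp add: vertex_label_def)
qed

lemma vertex_label_Tip:
  assumes "i \<in> {1..n}"
  shows "vertex_label (spider2 n) f (Tip i) = f {Mid i, Tip i}"
proof -
  have "{e \<in> edges (spider2 n). Tip i \<in> e} = {{Mid i, Tip i}}"
    using assms by (auto simp: edges_spider2)
  then show ?thesis
    by (simp add: vertex_label_def)
qed

lemma finite_verts_spider2: "finite (verts (spider2 n))"
  by (simp add: verts_spider2)

section \<open>The lower bound\<close>

text \<open>
  Induction on the cardinality, removing the largest element: it is at least \<open>card A\<close> because
  \<open>A \<subseteq> {1..Max A}\<close>.
\<close>

lemma sum_ge_of_distinct_positive:
  fixes A :: "nat set"
  assumes "finite A" "0 \<notin> A"
  shows "card A * (card A + 1) \<le> 2 * \<Sum>A"
  using assms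
proof (induction "card A" arbitrary: A)
  case 0
  then show ?case by simp
next
  case (Suc k)
  then have "A \<noteq> {}" by auto
  define m where "m = Max A"
  have m: "m \<in> A" using \<open>A \<noteq> {}\<close> Suc.prems by (simp add: m_def)
  have "A \<subseteq> {1..m}"
    using Suc.prems by (auto simp: m_def Suc_le_eq intro: gr0I)
  then have "Suc k \<le> m"
    using card_mono[of "{1..m}" A] Suc.hyps(2) by simp
  have "card (A - {m}) = k"
    using m Suc.hyps(2) Suc.prems by simp
  then have "k * (k + 1) \<le> 2 * \<Sum>(A - {m})"
    using Suc.hyps(1)[of "A - {m}"] Suc.prems by simp
  moreover have "\<Sum>A = m + \<Sum>(A - {m})"
    using m Suc.prems by (simp add: sum.remove)
  ultimately show ?case
    using \<open>Suc k \<le> m\<close> by (simp flip: Suc.hyps(2))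
qed

text \<open>
  The part common to both lower bounds. The leg \<open>j\<close> is the one with the edge labelled \<open>2n\<close>,
  whose other edge has a positive label; the tip colours are the pendant edge labels.
\<close>

lemma spider2_tip_and_large_colours:
  assumes "local_antimagic (spider2 n) f" and "n \<ge> 1"
  obtains j where "j \<in> {1..n}" "vertex_label (spider2 n) f (Mid j) > 2 * n"
    and "vertex_label (spider2 n) f ` Tip ` {1..n} \<subseteq> {1..2 * n}"
    and "card (vertex_label (spider2 n) f ` Tip ` {1..n}) = n"
proof -
  have inj: "inj_on f (edges (spider2 n))" and img: "f ` edges (spider2 n) = {1..2 * n}"
    using assms(1) by (simp_all add: local_antimagic_def bij_betw_def spider2_size)
  have range: "f {Centre, Mid i} \<in> {1..2 * n}" "f {Mid i, Tip i} \<in> {1..2 * n}"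
    if "i \<in> {1..n}" for i
    using that unfolding img[symmetric] edges_spider2 by blast+
  have "2 * n \<in> f ` edges (spider2 n)"
    using assms(2) by (simp add: img)
  then obtain j where j: "j \<in> {1..n}" "2 * n = f {Centre, Mid j} \<or> 2 * n = f {Mid j, Tip j}"
    unfolding edges_spider2 by blast
  have large: "vertex_label (spider2 n) f (Mid j) > 2 * n"
    using j range[OF j(1)] by (auto simp: vertex_label_Mid)
  have tips: "vertex_label (spider2 n) f ` Tip ` {1..n} = (\<lambda>i. f {Mid i, Tip i}) ` {1..n}"
    unfolding image_image by (intro image_cong refl vertex_label_Tip)
  have "inj_on (\<lambda>i. f {Mid i, Tip i}) {1..n}"
  proof (rule inj_onI)
    fix i k assume "i \<in> {1..n}" "k \<in> {1..n}" "f {Mid i, Tip i} = f {Mid k, Tip k}"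
    then have "{Mid i, Tip i} = {Mid k, Tip k}"
      by (intro inj_onD[OF inj]) (simp_all add: edges_spider2)
    then show "i = k" by (simp add: doubleton_eq_iff)
  qed
  then have "card (vertex_label (spider2 n) f ` Tip ` {1..n}) = n"
    unfolding tips by (simp add: card_image)
  moreover have "vertex_label (spider2 n) f ` Tip ` {1..n} \<subseteq> {1..2 * n}"
    unfolding tips using range by blast
  ultimately show thesis
    using that j(1) large by blast
qed

lemma num_colors_spider2_lower:
  assumes "local_antimagic (spider2 n) f" and "n \<ge> 1"
  shows "n + 1 \<le> num_colors (spider2 n) f"
proof -
  let ?L = "vertex_label (spider2 n) f"
  let ?T = "?L ` Tip ` {1..n}"
  obtain j where j: "j \<in> {1..n}" "?L (Mid j) > 2 * n" "?T \<subseteq> {1..2 * n}" "card ?T = n"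
    using spider2_tip_and_large_colours[OF assms] .
  have "?L (Mid j) \<notin> ?T"
    using j(2,3) by (meson atLeastAtMost_iff leD subsetD)
  then have "card (insert (?L (Mid j)) ?T) = n + 1"
    using j(4) by simp
  moreover have "insert (?L (Mid j)) ?T \<subseteq> ?L ` verts (spider2 n)"
    using j(1) by (auto simp: verts_spider2)
  ultimately show ?thesis
    unfolding num_colors_def by (metis card_mono finite_imageI finite_verts_spider2)
qed

lemma spider2_centre_colour_large:
  assumes "local_antimagic (spider2 n) f" and "n \<ge> 4"
  shows "vertex_label (spider2 n) f Centre > 2 * n"
proof -
  have inj: "inj_on f (edges (spider2 n))" and img: "f ` edges (spider2 n) = {1..2 * n}"
    using assms(1) by (simp_all add: local_antimagic_def bij_betw_def spider2_size)
  let ?A = "(\<lambda>i. f {Centre, Mid i}) ` {1..n}"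
  have inj': "inj_on (\<lambda>i. f {Centre, Mid i}) {1..n}"
  proof (rule inj_onI)
    fix i k assume "i \<in> {1..n}" "k \<in> {1..n}" "f {Centre, Mid i} = f {Centre, Mid k}"
    then have "{Centre, Mid i} = {Centre, Mid k}"
      by (intro inj_onD[OF inj]) (simp_all add: edges_spider2)
    then show "i = k" by (simp add: doubleton_eq_iff)
  qed
  have "?A \<subseteq> {1..2 * n}"
    unfolding img[symmetric] edges_spider2 by blast
  then have "0 \<notin> ?A" by (meson atLeastAtMost_iff not_one_le_zero subsetD)
  moreover have "card ?A = n" using inj' by (simp add: card_image)
  ultimately have "n * (n + 1) \<le> 2 * \<Sum>?A"
    using sum_ge_of_distinct_positive[of ?A] by simp
  also have "\<Sum>?A = vertex_label (spider2 n) f Centre"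
    using inj' by (simp add: sum.reindex vertex_label_Centre)
  finally have "n * (n + 1) \<le> 2 * vertex_label (spider2 n) f Centre" .
  moreover have "n * 5 \<le> n * (n + 1)"
    using assms(2) by (intro mult_le_mono) simp_all
  ultimately show ?thesis using assms(2) by linarith
qed

lemma num_colors_spider2_lower_large:
  assumes "local_antimagic (spider2 n) f" and "n \<ge> 4"
  shows "n + 2 \<le> num_colors (spider2 n) f"
proof -
  let ?L = "vertex_label (spider2 n) f"
  let ?T = "?L ` Tip ` {1..n}"
  have "n \<ge> 1" using assms(2) by simp
  then obtain j where j: "j \<in> {1..n}" "?L (Mid j) > 2 * n" "?T \<subseteq> {1..2 * n}" "card ?T = n"
    using spider2_tip_and_large_colours[OF assms(1)] by blast
  have "?L Centre \<noteq> ?L (Mid j)"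
    using assms(1) j(1) by (auto simp: local_antimagic_def verts_spider2 edges_spider2)
  moreover have "?L (Mid j) \<notin> ?T"
    using j(2,3) by (meson atLeastAtMost_iff leD subsetD)
  moreover have "?L Centre \<notin> ?T"
    using spider2_centre_colour_large[OF assms] j(3) by (meson atLeastAtMost_iff leD subsetD)
  ultimately have "card (insert (?L Centre) (insert (?L (Mid j)) ?T)) = n + 2"
    using j(4) by simp
  moreover have "insert (?L Centre) (insert (?L (Mid j)) ?T) \<subseteq> ?L ` verts (spider2 n)"
    using j(1) by (auto simp: verts_spider2)
  ultimately show ?thesis
    unfolding num_colors_def by (metis card_mono finite_imageI finite_verts_spider2)
qed

section \<open>An optimal labeling\<close>

text \<open>
  Labels are assigned to edges as sets of vertices, so the leg of an edge is read off from its
  unique middle vertex.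
\<close>

definition complementary_labeling :: "nat \<Rightarrow> spider_vertex set \<Rightarrow> nat" where
  "complementary_labeling n e =
     (let i = (THE i. Mid i \<in> e) in if Centre \<in> e then i else 2 * n + 1 - i)"

lemma complementary_labeling_inner: "complementary_labeling n {Centre, Mid i} = i"
  by (simp add: complementary_labeling_def)

lemma complementary_labeling_pendant:
  "complementary_labeling n {Mid i, Tip i} = 2 * n + 1 - i"
  by (simp add: complementary_labeling_def)

lemma image_reflect_interval: "(\<lambda>i. 2 * n + 1 - i) ` {1..n} = {n + 1..2 * n}" for n :: nat
proof
  show "{n + 1..2 * n} \<subseteq> (\<lambda>i. 2 * n + 1 - i) ` {1..n}"
  proof
    fix k assume "k \<in> {n + 1..2 * n}"
    then show "k \<in> (\<lambda>i. 2 * n + 1 - i) ` {1..n}"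
      by (intro image_eqI[of _ _ "2 * n + 1 - k"]) auto
  qed
qed auto

lemma bij_betw_complementary_labeling:
  "bij_betw (complementary_labeling n) (edges (spider2 n)) {1..2 * n}"
proof -
  have "complementary_labeling n ` edges (spider2 n) = {1..n} \<union> {n + 1..2 * n}"
    unfolding edges_spider2 image_Un image_image
      complementary_labeling_inner complementary_labeling_pendant image_reflect_interval
    by simp
  also have "\<dots> = {1..2 * n}" by auto
  finally have img: "complementary_labeling n ` edges (spider2 n) = {1..2 * n}" .
  have "finite (edges (spider2 n))" by (simp add: edges_spider2)
  then have "inj_on (complementary_labeling n) (edges (spider2 n))"
    by (rule eq_card_imp_inj_on) (simp add: img spider2_size)
  then show ?thesis using img by (simp add: bij_betw_def)
qed

lemma complementary_label_Centre:
  "vertex_label (spider2 n) (complementary_labeling n) Centre = n * (n + 1) div 2"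
  using gauss_sum_from_Suc_0[of n, where ?'a = nat]
  by (simp add: vertex_label_Centre complementary_labeling_inner)

lemma complementary_label_Mid:
  assumes "i \<in> {1..n}"
  shows "vertex_label (spider2 n) (complementary_labeling n) (Mid i) = 2 * n + 1"
  using assms
  by (simp add: vertex_label_Mid complementary_labeling_inner complementary_labeling_pendant)

lemma complementary_label_Tip:
  assumes "i \<in> {1..n}"
  shows "vertex_label (spider2 n) (complementary_labeling n) (Tip i) = 2 * n + 1 - i"
  using assms by (simp add: vertex_label_Tip complementary_labeling_pendant)

text \<open>
  Equality would mean \<open>n (n - 3) = 2\<close>, but the left-hand side is at most 0 for \<open>n \<le> 3\<close> and at
  least 4 for \<open>n \<ge> 4\<close>.
\<close>

lemma triangular_number_neq: "n * (n + 1) div 2 \<noteq> 2 * n + 1" for n :: nat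
proof
  assume eq: "n * (n + 1) div 2 = 2 * n + 1"
  have "2 * (n * (n + 1) div 2) = n * (n + 1)"
    by (intro dvd_mult_div_cancel) simp
  then have *: "n * (n + 1) = 4 * n + 2" using eq by linarith
  show False
  proof (cases "n \<le> 3")
    case True
    then have "n * (n + 1) \<le> n * 4" by (intro mult_le_mono) simp_all
    then show False using * by linarith
  next
    case False
    then have "n * 5 \<le> n * (n + 1)" by (intro mult_le_mono) simp_all
    then show False using * False by linarith
  qed
qed

lemma local_antimagic_complementary_labeling:
  "local_antimagic (spider2 n) (complementary_labeling n)"
proof -
  let ?L = "vertex_label (spider2 n) (complementary_labeling n)"
  have "?L x \<noteq> ?L y" if "{x, y} \<in> edges (spider2 n)" for x y
  proof -
    obtain i where i: "i \<in> {1..n}"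
      and "{x, y} = {Centre, Mid i} \<or> {x, y} = {Mid i, Tip i}"
      using \<open>{x, y} \<in> edges (spider2 n)\<close> unfolding edges_spider2 by blast
    moreover have "?L Centre \<noteq> ?L (Mid i)"
      unfolding complementary_label_Centre complementary_label_Mid[OF i]
      by (rule triangular_number_neq)
    moreover have "?L (Mid i) \<noteq> ?L (Tip i)"
      using i unfolding complementary_label_Mid[OF i] complementary_label_Tip[OF i] by auto
    ultimately show ?thesis
      by (auto simp: doubleton_eq_iff)
  qed
  then show ?thesis
    using bij_betw_complementary_labeling by (simp add: local_antimagic_def spider2_size)
qed

lemma num_colors_complementary_labeling:
  assumes "n \<ge> 1"
  shows "num_colors (spider2 n) (complementary_labeling n) =
    card (insert (n * (n + 1) div 2) {n + 1..2 * n + 1})"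
proof -
  let ?L = "vertex_label (spider2 n) (complementary_labeling n)"
  have "?L ` Mid ` {1..n} = {2 * n + 1}"
    using assms complementary_label_Mid by (auto simp: image_image)
  moreover have "?L ` Tip ` {1..n} = {n + 1..2 * n}"
    unfolding image_image image_reflect_interval[symmetric]
    by (intro image_cong refl complementary_label_Tip)
  ultimately have "?L ` verts (spider2 n) = {n * (n + 1) div 2} \<union> {2 * n + 1} \<union> {n + 1..2 * n}"
    unfolding verts_spider2 image_Un by (simp add: complementary_label_Centre)
  also have "\<dots> = insert (n * (n + 1) div 2) {n + 1..2 * n + 1}"
    by auto
  finally show ?thesis by (simp add: num_colors_def)
qed

theorem theorem1p3:
  fixes n :: nat
  assumes "n \<ge> 3"
  shows "local_antimagic_chromatic_number (spider2 n) = (if n \<ge> 4 then n + 2 else n + 1)"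
  unfolding local_antimagic_chromatic_number_def
proof (rule Least_equality)
  let ?k = "if n \<ge> 4 then n + 2 else n + 1"
  let ?f = "complementary_labeling n"
  have lower: "?k \<le> num_colors (spider2 n) f" if "local_antimagic (spider2 n) f" for f
    using num_colors_spider2_lower[OF that] num_colors_spider2_lower_large[OF that] assms
    by simp
  have "num_colors (spider2 n) ?f \<le> ?k"
  proof (cases "n \<ge> 4")
    case True
    then show ?thesis
      using card_insert_le_m1[of "n + 2" "{n + 1..2 * n + 1}"]
      by (simp add: num_colors_complementary_labeling)
  next
    case False
    then have "n = 3" using assms by simp
    \<comment> \<open>The centre has colour \<open>6\<close>, which lies in \<open>{4..7}\<close>.\<close>
    then show ?thesis
      by (simp add: num_colors_complementary_labeling insert_absorb)
  qed
  then have "num_colors (spider2 n) ?f = ?k"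
    using lower[OF local_antimagic_complementary_labeling] by simp
  then show "\<exists>f. local_antimagic (spider2 n) f \<and> num_colors (spider2 n) f = ?k"
    using local_antimagic_complementary_labeling by blast
  show "?k \<le> k" if "\<exists>f. local_antimagic (spider2 n) f \<and> num_colors (spider2 n) f = k" for k
    using that lower by blast
qed

end
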